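(* Let $m\ge 2$ and let $\langle\mathfrak{u},\mathfrak{w}\rangle$ be a graphical splitted bipartite degree sequence on $m+m$ vertices, i.e. with $m$ primary and $m$ secondary vertices. Let $\mathbf{d}$ be the split graph degree sequence generated from it, obtained by adding all possible edges within the primary class; that is, every primary degree is increased by $m-1$ and the secondary degrees are unchanged. Let $d_{\max}$ and $M$ be the maximum degree and the sum of the degrees in $\mathbf{d}$. Then $\mathbf{d}$ does not satisfy the condition $d_{\max}\le\frac14\sqrt{M}$.
   Context: A splitted bipartite degree sequence is the degree sequence of a bipartite graph with designated primary and secondary vertex classes, with the degrees of the two classes listed separately. It is graphical if it has such a bipartite realization. *)

theory Defs
  imports Complex_Main
begin

definition bipartite_graph :: "'v set \<Rightarrow> 'v set \<Rightarrow> 'v set set \<Rightarrow> bool" where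
  "bipartite_graph U W E \<longleftrightarrow> finite U \<and> finite W \<and> U \<inter> W = {} \<and>
     (\<forall>e\<in>E. \<exists>x\<in>U. \<exists>y\<in>W. e = {x, y})"

definition degree :: "'v set set \<Rightarrow> 'v \<Rightarrow> nat" where
  "degree E v = card {e \<in> E. v \<in> e}"

(* A splitted bipartite degree sequence is a pair of lists u, w. In a realization the
   i-th primary vertex is Inl i and the j-th secondary vertex is Inr j. *)

definition bipartite_realization :: "nat list \<Rightarrow> nat list \<Rightarrow> (nat + nat) set set \<Rightarrow> bool" where
  "bipartite_realization u w E \<longleftrightarrow>
     bipartite_graph (Inl ` {..<length u}) (Inr ` {..<length w}) E \<and>
     (\<forall>i<length u. degree E (Inl i) = u ! i) \<and>
     (\<forall>j<length w. degree E (Inr j) = w ! j)"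

definition graphical_bipartite :: "nat list \<Rightarrow> nat list \<Rightarrow> bool" where
  "graphical_bipartite u w \<longleftrightarrow> (\<exists>E. bipartite_realization u w E)"

(* Turning the primary class into a clique gives each of its vertices length u - 1 new
   neighbours. *)
definition split_degree_sequence :: "nat list \<Rightarrow> nat list \<Rightarrow> nat list" where
  "split_degree_sequence u w = map (\<lambda>k. k + (length u - 1)) u @ w"

end

(* Every degree is at most d_max, so M \<le> 2 * m * d_max, and the condition gives
   16 * d_max^2 \<le> M, hence 8 * d_max \<le> m. But the clique on the primary class forces
   d_max \<ge> m - 1, which is impossible for m \<ge> 2. *)

theory Submission imports Defs begin

text \<open>For the empty list \<open>Max {}\<close> is unspecified, but it is multiplied by
  0.\<close>

lemma sum_list_le_length_mult_Max:
  fixes xs :: "nat list"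
  shows "sum_list xs \<le> length xs * Max (set xs)"
  using sum_list_mono[of xs "\<lambda>x. x" "\<lambda>_. Max (set xs)"]
  by (simp add: sum_list_triv)

theorem theorem5p4:
  fixes m :: nat and u w d :: "nat list" and d_max M :: nat
  assumes "m \<ge> 2"
    and "length u = m" and "length w = m"
    and "graphical_bipartite u w"
    and "d = split_degree_sequence u w"
    and "d_max = Max (set d)" and "M = sum_list d"
  shows "\<not> (real d_max \<le> 1 / 4 * sqrt (real M))"
proof
  assume "real d_max \<le> 1 / 4 * sqrt (real M)"
  then have "4 * real d_max \<le> sqrt (real M)"
    by simp
  \<comment> \<open>Squaring is sound because \<open>4 * real d_max\<close> is nonnegative and so
    equals its absolute value.\<close>
  then have "(4 * real d_max)\<^sup>2 \<le> real M"
    by (intro sqrt_ge_absD) simp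
  then have "real (16 * d_max * d_max) \<le> real M"
    by (simp add: power2_eq_square)
  then have sq: "16 * d_max * d_max \<le> M"
    by (simp only: of_nat_le_iff)
  have "length d = 2 * m"
    using assms by (simp add: split_degree_sequence_def)
  then have "M \<le> 2 * m * d_max"
    using sum_list_le_length_mult_Max[of d] assms by simp
  with sq have le: "16 * d_max * d_max \<le> 2 * m * d_max"
    by linarith
  \<comment> \<open>Any primary vertex would do; index 0 exists since
    \<open>m \<ge> 2\<close>.\<close>
  have "u ! 0 + (m - 1) \<in> set d"
    using assms by (auto simp: split_degree_sequence_def)
  then have "u ! 0 + (m - 1) \<le> d_max"
    using assms by simp
  then have ge: "m - 1 \<le> d_max"
    by simp
  \<comment> \<open>The factor \<open>d_max\<close> cancels, being at least
    \<open>m - 1 \<ge> 1\<close>.\<close>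
  with \<open>m \<ge> 2\<close> le have "16 * d_max \<le> 2 * m"
    by simp
  \<comment> \<open>Now \<open>8 * (m - 1) \<le> m\<close>, that is
    \<open>7 * m \<le> 8\<close>.\<close>
  with ge \<open>m \<ge> 2\<close> show False
    by linarith
qed

end
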